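(* Let $\{Y_n:n\in\mathbb{N}_0\}$ be a family of classical orthogonal polynomials on the interval $I$ with weight function $W$ and let $\{\lambda_n:n\in\mathbb{N}_0\}$ be the corresponding family of eigenvalues. Let $M_n=\int_IW(x)(Y_n(x))^2\,\mathrm{d}x$ and let $K_n$ be the leading coefficient of $Y_n$. Setting, for $n\in\mathbb{N}_0$ and $x,y\in I$, $$D_{n+1}(x,y)=Y_{n+1}(x)Y_n(y)-Y_n(x)Y_{n+1}(y),$$ we have, for $N\in\mathbb{N}$, $$(x-y)\sum_{n=1}^N\frac{Y_n(x)Y_n(y)}{M_n\lambda_n}=\frac{K_N}{K_{N+1}M_N}\frac{D_{N+1}(x,y)}{\lambda_N}-\frac{K_0}{K_1M_0}\frac{D_1(x,y)}{\lambda_1}+\sum_{n=1}^{N-1}\frac{K_n}{K_{n+1}M_n}D_{n+1}(x,y)\left(\frac{1}{\lambda_n}-\frac{1}{\lambda_{n+1}}\right).$$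
   Context: $\mathbb{N}$ denotes the positive integers and $\mathbb{N}_0$ the non-negative integers. A family of classical orthogonal polynomials consists of real polynomials $Y_n$ of degree $n$ ($n\in\mathbb{N}_0$), a polynomial $Q$ of degree at most two, a linear function $L$ (polynomial of degree at most one), and mutually distinct constants $\lambda_n$ (the eigenvalues) with $QY_n''+LY_n'+\lambda_nY_n=0$ for all $n$. Here $I$ is a (possibly unbounded) interval, and $Q>0$ on its interior. With $R(x)=\exp\left(\int^x\frac{L(z)}{Q(z)}\,\mathrm{d}z\right)$ one sets $P=R$ and $W=R/Q$, so that $(PY_n')'=-\lambda_nWY_n$, and the $Y_n$ are orthogonal in $L^2(I,W(x)\,\mathrm{d}x)$ (all polynomials being integrable against $W$). The eigenvalues are $\lambda_n=-n\left(\frac{n-1}{2}Q''+L'\right)$, so that $\lambda_0=0$ and $\lambda_n\neq0$ for $n\geq1$. (These are exactly the families related by linear changes of variable to the Hermite, associated Laguerre and Jacobi polynomials with parameters $>-1$.) *)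

theory Defs
  imports "HOL-Analysis.Analysis" "HOL-Computational_Algebra.Polynomial"
begin

text \<open>
  The indefinite integral in \<open>R(x) = exp (\<integral>\<^sup>x L(z)/Q(z) dz)\<close> is read as an arbitrary
  antiderivative \<open>F\<close> of \<open>L/Q\<close> on the interior of \<open>I\<close>. There \<open>Q > 0\<close>; at an end point
  of \<open>I\<close> the polynomial \<open>Q\<close> may vanish, so \<open>R\<close> and \<open>W\<close> are left unconstrained there,
  which affects none of the integrals.

  The condition \<open>Y n \<noteq> 0\<close> only matters for \<open>n = 0\<close>, since \<open>degree 0 = 0\<close> in the library.
  The closed formula for the eigenvalues follows from \<open>ode\<close> and is therefore not assumed.
\<close>

locale classical_orthogonal_polynomials =
  fixes I :: "real set"
    and Q L :: "real poly"
    and R W :: "real \<Rightarrow> real"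
    and lam :: "nat \<Rightarrow> real"
    and Y :: "nat \<Rightarrow> real poly"
  assumes interval: "is_interval I"
    and nondegenerate: "interior I \<noteq> {}"
    and degree_Q: "degree Q \<le> 2"
    and degree_L: "degree L \<le> 1"
    and Q_pos: "\<And>x. x \<in> interior I \<Longrightarrow> poly Q x > 0"
    and degree_Y: "\<And>n. degree (Y n) = n"
    and Y_nonzero: "\<And>n. Y n \<noteq> 0"
    and lam_distinct: "inj lam"
    and ode: "\<And>n. Q * pderiv (pderiv (Y n)) + L * pderiv (Y n) + smult (lam n) (Y n) = 0"
    and R_eq: "\<exists>F. \<forall>x\<in>interior I.
          (F has_real_derivative poly L x / poly Q x) (at x) \<and> R x = exp (F x)"
    and W_eq: "\<And>x. x \<in> interior I \<Longrightarrow> W x = R x / poly Q x"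
    and integrable: "\<And>p. set_integrable lborel I (\<lambda>x. W x * poly p x)"
    and orthogonal: "\<And>m n. m \<noteq> n \<Longrightarrow>
          (LINT x:I|lborel. W x * (poly (Y m) x * poly (Y n) x)) = 0"

end

theory Submission
  imports Defs
begin

text \<open>
  The identity is the Christoffel-Darboux formula after a summation by parts. Write
  \<open>c n = K n / (K (n + 1) * M n)\<close>. An orthogonal family satisfies a three-term recurrence
  \<open>x * Y n = a * Y (n + 1) + b * Y n + c' * Y (n - 1)\<close>, where comparing leading coefficients gives
  \<open>a = K n / K (n + 1)\<close>, and testing against \<open>Y (n - 1)\<close>, with the factor \<open>x\<close> moved to the other
  side of the inner product, gives \<open>c' = (K (n - 1) / K n) * (M n / M (n - 1))\<close>. Multiplying the
  recurrence at \<open>x\<close> by \<open>Y n\<close> at \<open>y\<close> and antisymmetrising cancels the term with \<open>b\<close>; what is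
  left is the telescoping relation
  \<open>(x - y) * Y n x * Y n y / M n = c n * D (n + 1) x y - c (n - 1) * D n x y\<close> for \<open>n \<ge> 1\<close>
  (\<open>christoffel_darboux_step\<close>). Weighting it by \<open>1 / lam n\<close> and summing by parts
  (\<open>summation_by_parts\<close>) gives the result.

  The divisions by \<open>M n\<close> are harmless because the weight is positive almost everywhere
  on an interval with non-empty interior, so that \<open>M n > 0\<close> (\<open>weighted_norm_pos\<close>). The recurrence itself is pure algebra and is derived for an
  arbitrary linear functional on polynomials, of which integration against \<open>W\<close> is one instance.
\<close>

section \<open>Orthogonality with respect to a moment functional\<close>

locale orthogonal_polynomial_sequence =
  fixes \<Lambda> :: "'a::field poly \<Rightarrow> 'a" and Y :: "nat \<Rightarrow> 'a poly"
  assumes add: "\<Lambda> (p + q) = \<Lambda> p + \<Lambda> q"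
    and smult: "\<Lambda> (smult c p) = c * \<Lambda> p"
    and deg: "degree (Y n) = n"
    and nonzero: "Y n \<noteq> 0"
    and orth: "m \<noteq> n \<Longrightarrow> \<Lambda> (Y m * Y n) = 0"
    and norm_nonzero: "\<Lambda> (Y n * Y n) \<noteq> 0"
begin

lemma diff: "\<Lambda> (p - q) = \<Lambda> p - \<Lambda> q"
  using add[of "p - q" q] by simp

lemma zero: "\<Lambda> 0 = 0"
  using smult[of 0 0] by simp

lemma lead_nonzero: "coeff (Y n) n \<noteq> 0"
  using nonzero[of n] deg[of n] by (metis leading_coeff_0_iff)

lemma coeff_above: "n < i \<Longrightarrow> coeff (Y n) i = 0"
  by (simp add: coeff_eq_0 deg)

text \<open>
  The polynomials \<open>Y 0, \<dots>, Y (m - 1)\<close> span those of degree less than \<open>m\<close>: subtracting a multiple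
  of \<open>Y m\<close> kills the coefficient of degree \<open>m\<close>. The degree bound is phrased through coefficients
  so that \<open>m = 0\<close> means the zero polynomial.
\<close>

lemma orthogonal_to_lower_degree:
  assumes "m \<le> n" and "\<And>i. m \<le> i \<Longrightarrow> coeff p i = 0"
  shows "\<Lambda> (p * Y n) = 0"
  using assms
proof (induction m arbitrary: p)
  case 0
  then have "p = 0" by (simp add: poly_eq_iff)
  then show ?case by (simp add: zero)
next
  case (Suc m)
  define c where "c = coeff p m / coeff (Y m) m"
  have "\<Lambda> ((p - smult c (Y m)) * Y n) = 0"
  proof (rule Suc.IH)
    show "coeff (p - smult c (Y m)) i = 0" if "m \<le> i" for i
    proof (cases "i = m")
      case True
      then show ?thesis by (simp add: c_def lead_nonzero)
    next
      case False
      then show ?thesis using that Suc.prems(2)[of i] coeff_above[of m i] by simp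
    qed
  qed (use Suc.prems in simp)
  then show ?case
    using orth[of m n] Suc.prems(1) by (simp add: left_diff_distrib diff smult)
qed

text \<open>
  Against \<open>Y n\<close>, a polynomial of degree at most \<open>n\<close> is seen only through its top coefficient:
  it agrees with a multiple of \<open>Y n\<close> up to lower degree.
\<close>

lemma functional_times_eq_top_coeff:
  assumes "degree p \<le> n"
  shows "\<Lambda> (p * Y n) = coeff p n / coeff (Y n) n * \<Lambda> (Y n * Y n)"
proof -
  define c where "c = coeff p n / coeff (Y n) n"
  have "\<Lambda> ((p - smult c (Y n)) * Y n) = 0"
  proof (rule orthogonal_to_lower_degree[OF order_refl])
    show "coeff (p - smult c (Y n)) i = 0" if "n \<le> i" for i
    proof (cases "i = n")
      case True
      then show ?thesis by (simp add: c_def lead_nonzero)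
    next
      case False
      then show ?thesis using that assms coeff_above[of n i] by (simp add: coeff_eq_0)
    qed
  qed
  then show ?thesis by (simp add: left_diff_distrib diff smult c_def)
qed

text \<open>
  Testing a non-zero \<open>p\<close> against the \<open>Y\<close> of the same degree detects its leading coefficient.
\<close>

lemma eq_0_if_orthogonal:
  assumes "degree p \<le> n" and "\<And>k. k \<le> n \<Longrightarrow> \<Lambda> (p * Y k) = 0"
  shows "p = 0"
proof -
  have "lead_coeff p / coeff (Y (degree p)) (degree p) * \<Lambda> (Y (degree p) * Y (degree p)) = 0"
    using functional_times_eq_top_coeff[of p "degree p"] assms by simp
  then show ?thesis
    using lead_nonzero norm_nonzero by simp
qed

section \<open>The three-term recurrence and the Christoffel-Darboux relation\<close>

text \<open>
  The remainder \<open>r\<close> of \<open>x * Y (Suc n)\<close> after subtracting the three terms has degree at most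
  \<open>n + 1\<close>, by the choice of \<open>a\<close>, and is orthogonal to every \<open>Y k\<close> with \<open>k \<le> n + 1\<close>: for
  \<open>k = n + 1\<close> by the choice of \<open>b\<close>, for \<open>k = n\<close> by that of \<open>c\<close>, and for smaller \<open>k\<close>
  because the factor \<open>x\<close> can be moved to \<open>Y k\<close>, and \<open>x * Y k\<close> has degree less than \<open>n + 1\<close>.
\<close>

lemma three_term_recurrence:
  defines "K \<equiv> \<lambda>n. coeff (Y n) n" and "h \<equiv> \<lambda>n. \<Lambda> (Y n * Y n)"
  shows "\<exists>b. pCons 0 (Y (Suc n)) =
    smult (K (Suc n) / K (Suc (Suc n))) (Y (Suc (Suc n))) + smult b (Y (Suc n))
    + smult (K n / K (Suc n) * h (Suc n) / h n) (Y n)"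
proof -
  let ?x = "\<lambda>p. pCons 0 p :: 'a poly"
  define a where "a = K (Suc n) / K (Suc (Suc n))"
  define b where "b = \<Lambda> (?x (Y (Suc n)) * Y (Suc n)) / h (Suc n)"
  define c where "c = K n / K (Suc n) * h (Suc n) / h n"
  define r where "r = ?x (Y (Suc n)) - smult a (Y (Suc (Suc n)))
    - smult b (Y (Suc n)) - smult c (Y n)"
  have "coeff r i = 0" if "Suc n < i" for i
  proof (cases "i = Suc (Suc n)")
    case True
    then show ?thesis using lead_nonzero
      by (simp add: r_def a_def K_def coeff_above)
  next
    case False
    with that show ?thesis
      by (simp add: r_def coeff_above coeff_pCons split: nat.split)
  qed
  then have deg_r: "degree r \<le> Suc n"
    by (simp add: degree_le)
  have expand: "\<Lambda> (r * Y k) = \<Lambda> (?x (Y k) * Y (Suc n)) - a * \<Lambda> (Y (Suc (Suc n)) * Y k)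
      - b * \<Lambda> (Y (Suc n) * Y k) - c * \<Lambda> (Y n * Y k)" for k
    by (simp add: r_def left_diff_distrib right_diff_distrib diff smult mult.commute)
  have "r = 0"
  proof (rule eq_0_if_orthogonal[OF deg_r])
    fix k assume "k \<le> Suc n"
    then consider "k = Suc n" | "k = n" | "k < n" by linarith
    then show "\<Lambda> (r * Y k) = 0"
    proof cases
      case 1
      then show ?thesis
        unfolding expand by (simp add: orth b_def h_def norm_nonzero)
    next
      case 2
      have "\<Lambda> (?x (Y n) * Y (Suc n)) = K n / K (Suc n) * h (Suc n)"
        using functional_times_eq_top_coeff[of "?x (Y n)" "Suc n"]
        by (simp add: deg nonzero K_def h_def)
      with 2 show ?thesis
        unfolding expand by (simp add: orth c_def h_def norm_nonzero)
    next
      case 3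
      have "\<Lambda> (?x (Y k) * Y (Suc n)) = 0"
        using 3 functional_times_eq_top_coeff[of "?x (Y k)" "Suc n"]
        by (simp add: deg nonzero coeff_above)
      with 3 show ?thesis
        unfolding expand by (simp add: orth)
    qed
  qed
  then have "?x (Y (Suc n)) = smult a (Y (Suc (Suc n))) + smult b (Y (Suc n))
      + smult c (Y n)"
    by (simp add: r_def algebra_simps)
  then show ?thesis unfolding a_def c_def by blast
qed

text \<open>
  Antisymmetrising the recurrence in \<open>x\<close> and \<open>y\<close> removes its middle term; division by the squared
  norm turns the two remaining coefficients into consecutive values of the same sequence, so that
  the right-hand sides telescope.
\<close>

lemma christoffel_darboux_step:
  fixes x y :: 'a
  defines "K \<equiv> \<lambda>n. coeff (Y n) n" and "h \<equiv> \<lambda>n. \<Lambda> (Y n * Y n)"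
    and "D \<equiv> \<lambda>n. poly (Y (Suc n)) x * poly (Y n) y - poly (Y n) x * poly (Y (Suc n)) y"
  shows "(x - y) * (poly (Y (Suc n)) x * poly (Y (Suc n)) y) / h (Suc n) =
    K (Suc n) / (K (Suc (Suc n)) * h (Suc n)) * D (Suc n) - K n / (K (Suc n) * h n) * D n"
proof -
  obtain b where "pCons 0 (Y (Suc n)) =
      smult (K (Suc n) / K (Suc (Suc n))) (Y (Suc (Suc n)))
      + smult b (Y (Suc n))
      + smult (K n / K (Suc n) * h (Suc n) / h n) (Y n)"
    using three_term_recurrence[of n] unfolding K_def h_def by blast
  from arg_cong[OF this, of poly]
  have rec: "z * poly (Y (Suc n)) z = K (Suc n) / K (Suc (Suc n)) * poly (Y (Suc (Suc n))) z
      + b * poly (Y (Suc n)) z + K n / K (Suc n) * h (Suc n) / h n * poly (Y n) z" for z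
    by (simp add: fun_eq_iff)
  have "(x - y) * (poly (Y (Suc n)) x * poly (Y (Suc n)) y) =
      (x * poly (Y (Suc n)) x) * poly (Y (Suc n)) y - poly (Y (Suc n)) x * (y * poly (Y (Suc n)) y)"
    by (simp add: algebra_simps)
  also have "\<dots> = K (Suc n) / K (Suc (Suc n)) * D (Suc n) - K n / K (Suc n) * h (Suc n) / h n * D n"
    unfolding rec D_def by (simp add: algebra_simps)
  finally show ?thesis
    using norm_nonzero[of "Suc n"] by (simp add: h_def diff_divide_distrib)
qed

end

lemma summation_by_parts:
  fixes u v :: "nat \<Rightarrow> 'a::comm_ring"
  assumes "N \<ge> 1"
  shows "(\<Sum>n=1..N. (u n - u (n - 1)) * v n) =
    u N * v N - u 0 * v 1 + (\<Sum>n=1..N-1. u n * (v n - v (n + 1)))"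
  using assms
proof (induction N rule: dec_induct)
  case base
  then show ?case by (simp add: algebra_simps)
next
  case (step N)
  then obtain m where "N = Suc m" by (cases N) auto
  with step.IH show ?case by (simp add: algebra_simps)
qed

section \<open>Integration against the weight\<close>

text \<open>
  An interval differs from its interior by a null set (the frontier of a convex set), and on the
  interior \<open>W\<close> is the quotient of an exponential by the positive polynomial \<open>Q\<close>. A vanishing
  integral would therefore force \<open>p\<close> to vanish almost everywhere on a non-empty open set, which
  the finitely many roots of \<open>p\<close> cannot cover.
\<close>

lemma (in classical_orthogonal_polynomials) weighted_norm_pos:
  assumes "p \<noteq> 0"
  shows "(LINT x:I|lborel. W x * (poly p x)\<^sup>2) > 0"
proof -
  let ?g = "\<lambda>x. indicator I x *\<^sub>R (W x * (poly p x)\<^sup>2)"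
  have W_pos: "W x > 0" if "x \<in> interior I" for x
    using that R_eq Q_pos[OF that] W_eq[OF that] by (metis divide_pos_pos exp_gt_zero)
  have "negligible (frontier I)"
    using interval by (simp add: negligible_convex_frontier is_interval_convex)
  then have "frontier I \<in> null_sets lebesgue"
    by (simp add: negligible_iff_null_sets)
  then have "frontier I \<in> null_sets lborel"
    by (simp add: null_sets_completion_iff)
  then have off_frontier: "AE x in lborel. x \<notin> frontier I"
    by (rule AE_not_in)
  have nonneg: "AE x in lborel. 0 \<le> ?g x"
    using off_frontier
  proof eventually_elim
    case (elim x)
    then have "x \<in> I \<Longrightarrow> x \<in> interior I"
      using closure_subset[of I] by (auto simp: frontier_def)
    then show ?case using W_pos[of x] by (cases "x \<in> I") auto
  qed
  have int: "integrable lborel ?g"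
    using integrable[of "p ^ 2"] by (simp add: set_integrable_def)
  have "(LINT x|lborel. ?g x) \<noteq> 0"
  proof
    assume "(LINT x|lborel. ?g x) = 0"
    then have "AE x in lborel. ?g x = 0"
      using integral_nonneg_eq_0_iff_AE[OF int nonneg] by simp
    moreover have "AE x in lborel. x \<notin> {x. poly p x = 0}"
      by (intro AE_not_in finite_imp_null_set_lborel poly_roots_finite assms)
    ultimately have "AE x in lborel. x \<notin> interior I"
    proof eventually_elim
      case (elim x)
      then show ?case using W_pos[of x] interior_subset[of I] by (auto simp: indicator_def)
    qed
    then have "emeasure lborel (interior I) = 0"
      by (simp add: AE_iff_measurable[OF _ refl])
    then have "negligible (interior I)"
      by (simp add: negligible_iff_emeasure0)
    then show False
      using open_not_negligible[OF open_interior nondegenerate] by simp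
  qed
  moreover have "(LINT x|lborel. ?g x) \<ge> 0"
    using nonneg by (rule integral_nonneg_AE)
  ultimately show ?thesis
    by (simp add: set_lebesgue_integral_def)
qed

lemma (in classical_orthogonal_polynomials) orthogonal_polynomial_sequence_integral:
  "orthogonal_polynomial_sequence (\<lambda>p. LINT x:I|lborel. W x * poly p x) Y"
proof
  show "(LINT x:I|lborel. W x * poly (p + q) x) =
      (LINT x:I|lborel. W x * poly p x) + (LINT x:I|lborel. W x * poly q x)" for p q
    using set_integral_add(2)[OF integrable[of p] integrable[of q]]
    by (simp add: distrib_left)
  show "(LINT x:I|lborel. W x * poly (smult c p) x) = c * (LINT x:I|lborel. W x * poly p x)" for c p
    using set_integral_mult_right[of lborel I c "\<lambda>x. W x * poly p x"]
    by (simp add: mult.left_commute)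
  show "(LINT x:I|lborel. W x * poly (Y n * Y n) x) \<noteq> 0" for n
    using weighted_norm_pos[OF Y_nonzero[of n]] by (simp add: power2_eq_square)
qed (use degree_Y Y_nonzero orthogonal in simp_all)

section \<open>The kernel weighted by reciprocal eigenvalues\<close>

theorem proposition3p4:
  fixes I :: "real set"
    and Q L :: "real poly"
    and R W :: "real \<Rightarrow> real"
    and lam M K :: "nat \<Rightarrow> real"
    and Y :: "nat \<Rightarrow> real poly"
    and D :: "nat \<Rightarrow> real \<Rightarrow> real \<Rightarrow> real"
    and N :: nat
    and x y :: real
  assumes "classical_orthogonal_polynomials I Q L R W lam Y"
    and "\<And>n. M n = (LINT x:I|lborel. W x * (poly (Y n) x)\<^sup>2)"
    and "\<And>n. K n = lead_coeff (Y n)"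
    and "\<And>n x y. x \<in> I \<Longrightarrow> y \<in> I \<Longrightarrow>
           D (n + 1) x y = poly (Y (n + 1)) x * poly (Y n) y - poly (Y n) x * poly (Y (n + 1)) y"
    and "N \<ge> 1"
    and "x \<in> I" and "y \<in> I"
  shows "(x - y) * (\<Sum>n=1..N. poly (Y n) x * poly (Y n) y / (M n * lam n)) =
           K N / (K (N + 1) * M N) * (D (N + 1) x y / lam N)
           - K 0 / (K 1 * M 0) * (D 1 x y / lam 1)
           + (\<Sum>n=1..N-1. K n / (K (n + 1) * M n) * D (n + 1) x y * (1 / lam n - 1 / lam (n + 1)))"
proof -
  interpret classical_orthogonal_polynomials I Q L R W lam Y
    by (fact assms(1))
  interpret ops: orthogonal_polynomial_sequence "\<lambda>p. LINT x:I|lborel. W x * poly p x" Y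
    by (rule orthogonal_polynomial_sequence_integral)
  define u where "u n = K n / (K (n + 1) * M n) * D (n + 1) x y" for n
  have M: "(LINT x:I|lborel. W x * poly (Y n * Y n) x) = M n" for n
    by (simp add: assms(2) power2_eq_square)
  have K: "coeff (Y n) n = K n" for n
    by (simp add: assms(3) degree_Y)
  have step: "(x - y) * (poly (Y n) x * poly (Y n) y) / M n = u n - u (n - 1)" if "n \<ge> 1" for n
  proof -
    from that obtain m where n: "n = Suc m" by (cases n) auto
    show ?thesis
      using ops.christoffel_darboux_step[of x y m] assms(4)[OF assms(6,7), of n]
        assms(4)[OF assms(6,7), of m]
      unfolding M K by (simp add: n u_def)
  qed
  have "(x - y) * (\<Sum>n=1..N. poly (Y n) x * poly (Y n) y / (M n * lam n)) =
      (\<Sum>n=1..N. (x - y) * (poly (Y n) x * poly (Y n) y) / M n * (1 / lam n))"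
    by (simp add: sum_distrib_left)
  also have "\<dots> = (\<Sum>n=1..N. (u n - u (n - 1)) * (1 / lam n))"
    by (rule sum.cong) (simp_all only: step atLeastAtMost_iff)
  also have "\<dots> = u N * (1 / lam N) - u 0 * (1 / lam 1)
      + (\<Sum>n=1..N-1. u n * (1 / lam n - 1 / lam (n + 1)))"
    using assms(5) by (rule summation_by_parts)
  finally show ?thesis
    by (simp add: u_def)
qed

end
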